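(* Let $B$ be a barrier on an infinite set $X\subseteq\mathbb{N}$ and let $k\in\mathbb{N}$. For every $k$-bounded function $f:B\to\mathbb{N}$ there exists a barrier $B'\subseteq B$ such that $f$ is injective on $B'$.
   Context: $\mathbb{N}$ is the set of natural numbers (including $0$). Subsets of $\mathbb{N}$ are identified with their strictly increasing enumerations; $s\sqsubset Y$ means that $s$ is a proper initial segment of $Y$ as a sequence; $\subset$ is strict set inclusion. A set $B$ of finite subsets of $\mathbb{N}$ is a barrier on an infinite set $X\subseteq\mathbb{N}$ if: (1) $\bigcup B=X$; (2) for all $s,t\in B$, $s\not\subset t$; (3) for every infinite $Y\subseteq X$ there is $s\in B$ with $s\sqsubset Y$. The set $b(B)=\bigcup B$ is called the base of $B$. A family $B'$ is called a barrier if it is a barrier on its base $b(B')$ (in particular $b(B')$ is infinite). A function $f:B\to\mathbb{N}$ is $k$-bounded if $|f^{-1}(x)|\le k$ for every $x\in\mathbb{N}$. *)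

theory Defs
  imports Main "HOL-Library.Infinite_Set"
begin

text \<open>
  On a finite set \<open>s\<close> of naturals, \<open>enumerate s i\<close> is the \<open>i\<close>-th element of \<open>s\<close> in increasing
  order for \<open>i < card s\<close>, and is unspecified beyond that.
\<close>

definition proper_init_seg :: "nat set \<Rightarrow> nat set \<Rightarrow> bool" where
  "proper_init_seg s Y \<longleftrightarrow>
     finite s \<and> (finite Y \<longrightarrow> card s < card Y) \<and>
     (\<forall>i<card s. enumerate s i = enumerate Y i)"

definition barrier_on :: "nat set set \<Rightarrow> nat set \<Rightarrow> bool" where
  "barrier_on B X \<longleftrightarrow>
     infinite X \<and> (\<forall>s\<in>B. finite s) \<and>
     \<Union>B = X \<and>
     (\<forall>s\<in>B. \<forall>t\<in>B. \<not> s \<subset> t) \<and>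
     (\<forall>Y. infinite Y \<and> Y \<subseteq> X \<longrightarrow> (\<exists>s\<in>B. proper_init_seg s Y))"

definition base :: "nat set set \<Rightarrow> nat set" where
  "base B = \<Union>B"

definition barrier :: "nat set set \<Rightarrow> bool" where
  "barrier B \<longleftrightarrow> barrier_on B (base B)"

text \<open>The finiteness conjunct is needed because \<open>card\<close> of an infinite set is 0.\<close>

definition bounded_fun_on :: "nat \<Rightarrow> ('a \<Rightarrow> nat) \<Rightarrow> 'a set \<Rightarrow> bool" where
  "bounded_fun_on k f B \<longleftrightarrow>
     (\<forall>x. finite {s \<in> B. f s = x} \<and> card {s \<in> B. f s = x} \<le> k)"

end

theory Submission
  imports Defs
begin

text \<open>
  Number the elements of each fibre of \<open>f\<close> by values below \<open>k\<close>. This is a finite colouring of \<open>B\<close>,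
  and \<open>f\<close> is injective on every set of a single colour. So it suffices to have the Nash-Williams
  theorem: a finite colouring of a barrier is constant on the members contained in some infinite
  set. That is proved by bar induction along initial segments: homogeneity above every one-point
  end-extension of \<open>s\<close> yields homogeneity above \<open>s\<close> by a diagonal sequence and the pigeonhole
  principle, and a failure at the empty segment would produce an infinite set without an initial
  segment in \<open>B\<close>.
\<close>

section \<open>Initial segments in terms of the order\<close>

definition init_seg :: "nat set \<Rightarrow> nat set \<Rightarrow> bool" where
  "init_seg s t \<longleftrightarrow> s \<subseteq> t \<and> (\<forall>y\<in>s. \<forall>x\<in>t - s. y < x)"

lemma init_seg_insert:
  assumes "init_seg s t" "\<forall>y\<in>t. y < n"
  shows "init_seg s (insert n t)"
  using assms unfolding init_seg_def by (metis DiffD1 DiffD2 DiffI insertE subsetD subset_insertI2)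

text \<open>If neither set contained the other, an element of \<open>s - t\<close> and an element of
  \<open>t - s\<close> would each lie below the other.\<close>

lemma init_seg_linear:
  assumes "init_seg s Y" "init_seg t Y"
  shows "s \<subseteq> t \<or> t \<subseteq> s"
proof (rule ccontr)
  assume "\<not> ?thesis"
  then obtain a b where "a \<in> s" "a \<notin> t" "b \<in> t" "b \<notin> s" by blast
  with assms have "a < b" "b < a" unfolding init_seg_def by blast+
  then show False by simp
qed

text \<open>Bridge from enumerations to the order: \<open>s\<close> consists of the first
  \<open>card s\<close> values of \<open>enumerate Y\<close>, which is strictly increasing. Unlike
  \<open>proper_init_seg\<close>, \<open>init_seg\<close> permits equality.\<close>

lemma proper_init_seg_imp_init_seg:
  assumes "proper_init_seg s Y" "infinite Y"
  shows "init_seg s Y"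
proof -
  have "finite s" and eq: "\<And>i. i < card s \<Longrightarrow> enumerate s i = enumerate Y i"
    using assms unfolding proper_init_seg_def by auto
  have "s = enumerate s ` {..<card s}"
    using finite_bij_enumerate[OF \<open>finite s\<close>] by (simp add: bij_betw_def)
  also have "\<dots> = enumerate Y ` {..<card s}"
    using eq by (intro image_cong) auto
  finally have s: "s = enumerate Y ` {..<card s}" .
  show ?thesis
    unfolding init_seg_def
  proof (intro conjI ballI)
    show "s \<subseteq> Y"
      using enumerate_in_set[OF \<open>infinite Y\<close>] by (subst s) auto
    fix y x assume "y \<in> s" "x \<in> Y - s"
    obtain i where i: "i < card s" "y = enumerate Y i"
      using \<open>y \<in> s\<close> s by blast
    obtain j where j: "x = enumerate Y j"
      using \<open>x \<in> Y - s\<close> range_enumerate[OF \<open>infinite Y\<close>] by blast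
    have "\<not> j < card s"
      using \<open>x \<in> Y - s\<close> s j by blast
    then show "y < x"
      using i j enumerate_mono[OF _ \<open>infinite Y\<close>] by simp
  qed
qed

section \<open>Restriction of a barrier to an infinite set\<close>

lemma empty_notin_barrier:
  assumes "barrier_on B X"
  shows "{} \<notin> B"
proof
  assume "{} \<in> B"
  then have "\<forall>t\<in>B. t = {}"
    using assms unfolding barrier_on_def by (metis bot.not_eq_extremum)
  then have "\<Union>B = {}" by blast
  then show False
    using assms unfolding barrier_on_def by auto
qed

text \<open>An initial segment of a set \<open>Y \<subseteq> Z\<close> is contained in
  \<open>Z\<close>, so the member of \<open>B\<close> that \<open>Y\<close> begins with survives the
  restriction.\<close>

lemma barrier_restrict:
  assumes B: "barrier_on B X" and Z: "infinite Z" "Z \<subseteq> X"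
  shows "barrier {s \<in> B. s \<subseteq> Z}" (is "barrier ?B'")
proof -
  have seg: "\<exists>s\<in>?B'. proper_init_seg s Y" if Y: "infinite Y" "Y \<subseteq> Z" for Y
  proof -
    obtain s where s: "s \<in> B" "proper_init_seg s Y"
      using B Y Z unfolding barrier_on_def by (meson subset_trans)
    then have "s \<subseteq> Y"
      using proper_init_seg_imp_init_seg Y unfolding init_seg_def by blast
    with s Y show ?thesis by blast
  qed
  have sub: "\<Union>?B' \<subseteq> Z" by blast
  have "infinite (\<Union>?B')"
    unfolding infinite_nat_iff_unbounded
  proof
    \<comment> \<open>The tail of \<open>Z\<close> beyond \<open>m\<close> begins with a nonempty
      member, which puts an element above \<open>m\<close> into the base.\<close>
    fix m
    have "infinite (Z - {..m})" using Z by simp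
    from seg[OF this] obtain s where s: "s \<in> ?B'" "proper_init_seg s (Z - {..m})" by auto
    then have "s \<subseteq> Z - {..m}"
      using proper_init_seg_imp_init_seg \<open>infinite (Z - {..m})\<close> unfolding init_seg_def by blast
    moreover have "s \<noteq> {}"
      using s empty_notin_barrier[OF B] by auto
    ultimately obtain x where "x \<in> s" "x > m" by (auto simp: subset_iff not_le)
    then show "\<exists>n>m. n \<in> \<Union>?B'" using s by blast
  qed
  moreover have "\<forall>s\<in>?B'. finite s" "\<forall>s\<in>?B'. \<forall>t\<in>?B'. \<not> s \<subset> t"
    using B unfolding barrier_on_def by auto
  moreover have "\<forall>Y. infinite Y \<and> Y \<subseteq> \<Union>?B' \<longrightarrow> (\<exists>s\<in>?B'. proper_init_seg s Y)"
    using seg sub by (meson subset_trans)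
  ultimately show ?thesis
    unfolding barrier_def barrier_on_def base_def by blast
qed

section \<open>Homogeneity above a finite segment\<close>

definition homogenizable ::
  "nat set set \<Rightarrow> (nat set \<Rightarrow> 'c) \<Rightarrow> 'c set \<Rightarrow> nat set \<Rightarrow> nat set \<Rightarrow> bool" where
  "homogenizable B col C s Y \<longleftrightarrow>
     (\<exists>Z\<subseteq>Y. infinite Z \<and> (\<exists>c\<in>C. \<forall>t\<in>B. init_seg s t \<and> t - s \<subseteq> Z \<longrightarrow> col t = c))"

text \<open>Diagonal argument: \<open>ext\<close> holds for every infinite \<open>Y\<close>, so it
  can be reapplied inside ever smaller sets, once for each new point. The colour may depend on the
  point; the pigeonhole principle then fixes one colour.\<close>

lemma homogenizable_step:
  assumes "finite C" "s \<notin> B" "finite s" "infinite Y" "Y \<subseteq> X"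
    and ext: "\<And>n Y. n \<in> X \<Longrightarrow> \<forall>y\<in>s. y < n \<Longrightarrow> infinite Y \<Longrightarrow> Y \<subseteq> X \<Longrightarrow>
                homogenizable B col C (insert n s) Y"
  shows "homogenizable B col C s Y"
proof -
  \<comment> \<open>Only finitely many points of \<open>Y\<close> are lost, and each remaining point
    end-extends \<open>s\<close>.\<close>
  define Y0 where "Y0 = {y \<in> Y. \<forall>x\<in>s. x < y}"
  have "Y - Y0 \<subseteq> (\<Union>x\<in>s. {..x})"
    unfolding Y0_def by (auto simp: not_less)
  then have "finite (Y - Y0)"
    using \<open>finite s\<close> finite_subset by blast
  then have inf0: "infinite Y0"
    using \<open>infinite Y\<close> finite_Diff2 by blast
  let ?n = "\<lambda>Z::nat set. LEAST x. x \<in> Z"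
  define hom where "hom c n Z \<longleftrightarrow>
      (\<forall>t\<in>B. init_seg (insert n s) t \<and> t - insert n s \<subseteq> Z \<longrightarrow> col t = c)" for c n Z
  \<comment> \<open>\<open>F (Suc i)\<close> omits the least point of \<open>F i\<close> and is
    homogeneous above \<open>s\<close> with that point added.\<close>
  have "\<exists>F. \<forall>i. (infinite (F i) \<and> F i \<subseteq> Y0) \<and>
      (F (Suc i) \<subseteq> F i - {?n (F i)} \<and> (\<exists>c\<in>C. hom c (?n (F i)) (F (Suc i))))"
  proof (rule dependent_nat_choice)
    show "\<exists>Z. infinite Z \<and> Z \<subseteq> Y0" using inf0 by blast
  next
    fix Z and i :: nat
    assume Z: "infinite Z \<and> Z \<subseteq> Y0"
    then have "?n Z \<in> Z"
      by (metis LeastI ex_in_conv finite.emptyI)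
    then have n: "?n Z \<in> X" "\<forall>y\<in>s. y < ?n Z"
      using Z \<open>Y \<subseteq> X\<close> unfolding Y0_def by blast+
    have "infinite (Z - {?n Z})" "Z - {?n Z} \<subseteq> X"
      using Z \<open>Y \<subseteq> X\<close> unfolding Y0_def by auto
    from ext[OF n this] obtain W where
      "W \<subseteq> Z - {?n Z}" "infinite W" "\<exists>c\<in>C. hom c (?n Z) W"
      unfolding homogenizable_def hom_def by blast
    moreover from this have "W \<subseteq> Y0" using Z by blast
    ultimately show "\<exists>W. (infinite W \<and> W \<subseteq> Y0) \<and> W \<subseteq> Z - {?n Z} \<and> (\<exists>c\<in>C. hom c (?n Z) W)"
      by blast
  qed
  then obtain F where F: "\<And>i. infinite (F i)" "\<And>i. F i \<subseteq> Y0"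
      "\<And>i. F (Suc i) \<subseteq> F i - {?n (F i)}"
      "\<And>i. \<exists>c\<in>C. hom c (?n (F i)) (F (Suc i))"
    by blast
  define n where "n i = ?n (F i)" for i
  have nF: "n i \<in> F i" for i
    unfolding n_def using F(1) by (metis LeastI ex_in_conv finite.emptyI)
  have n_least: "n i \<le> x" if "x \<in> F i" for i x
    unfolding n_def using that by (rule Least_le)
  have F_mono: "F j \<subseteq> F i" if "i \<le> j" for i j
    by (rule lift_Suc_antimono_le[OF _ that]) (use F(3) in blast)
  have "n i < n (Suc i)" for i
    using n_least[of "n (Suc i)" i] nF[of "Suc i"] F(3)[of i]
    unfolding n_def by (metis DiffE insertI1 le_neq_implies_less subset_eq)
  then have n_strict: "strict_mono n"
    by (simp add: strict_mono_Suc_iff)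
  have "\<forall>i. \<exists>c. c \<in> C \<and> hom c (n i) (F (Suc i))"
    using F(4) unfolding n_def by blast
  from choice[OF this] obtain c where c: "\<And>i. c i \<in> C" "\<And>i. hom (c i) (n i) (F (Suc i))"
    by blast
  have "finite (range c)"
    using c(1) \<open>finite C\<close> by (meson finite_subset image_subsetI)
  then obtain d where d: "d \<in> C" "infinite {i. c i = d}"
    using pigeonhole_infinite[of UNIV c] c(1) by auto
  define W where "W = n ` {i. c i = d}"
  have "infinite W"
    unfolding W_def using d n_strict
    by (metis finite_imageD strict_mono_imp_inj_on)
  moreover have "W \<subseteq> Y"
    unfolding W_def using nF F(2) Y0_def by blast
  moreover have "col t = d" if t: "t \<in> B" "init_seg s t" "t - s \<subseteq> W" for t
  proof -
    \<comment> \<open>Since \<open>s \<notin> B\<close>, \<open>t\<close> properly extends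
      \<open>s\<close>. The first new point \<open>n i\<close> determines which homogeneous set
      governs \<open>t\<close>.\<close>
    let ?m = "LEAST x. x \<in> t - s"
    have "t - s \<noteq> {}"
      using t(1,2) \<open>s \<notin> B\<close> unfolding init_seg_def by (metis Diff_eq_empty_iff subset_antisym)
    then have m: "?m \<in> t - s" using LeastI[of "\<lambda>x. x \<in> t - s"] by blast
    have least: "?m \<le> x" if "x \<in> t - s" for x using that by (rule Least_le)
    obtain i where i: "?m = n i" "c i = d"
      using subsetD[OF t(3) m] unfolding W_def by blast
    have lt: "n i < x" if "x \<in> t - insert (n i) s" for x
      using least[of x] that i(1) by (metis DiffD1 DiffD2 DiffI insertCI le_neq_implies_less)
    have "init_seg (insert (n i) s) t"
      using t(2) m lt unfolding init_seg_def i(1) by blast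
    \<comment> \<open>The later points of \<open>t\<close> are values \<open>n j\<close> with
      \<open>j > i\<close>, and these lie in \<open>F j \<subseteq> F (Suc i)\<close>.\<close>
    moreover have "t - insert (n i) s \<subseteq> F (Suc i)"
    proof
      fix x assume x: "x \<in> t - insert (n i) s"
      then have "x \<in> W" using t(3) by blast
      then obtain j where "x = n j" unfolding W_def by blast
      then have "Suc i \<le> j"
        using lt[OF x] strict_mono_less[OF n_strict] by auto
      then show "x \<in> F (Suc i)"
        using \<open>x = n j\<close> nF F_mono by blast
    qed
    ultimately show ?thesis using c(2)[of i] i t unfolding hom_def by blast
  qed
  ultimately show ?thesis
    unfolding homogenizable_def using d(1) by (intro exI[of _ W]) auto
qed

text \<open>By the antichain condition \<open>s\<close> is the only member of \<open>B\<close>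
  extending \<open>s\<close>, so \<open>Y\<close> itself works with the colour
  \<open>col s\<close>.\<close>

lemma homogenizable_in_barrier:
  assumes "barrier_on B X" "s \<in> B" "col s \<in> C" "infinite Y"
  shows "homogenizable B col C s Y"
proof -
  have "t = s" if "t \<in> B" "init_seg s t" for t
    using assms that unfolding barrier_on_def init_seg_def by blast
  then show ?thesis
    unfolding homogenizable_def using assms by blast
qed

theorem Nash_Williams:
  assumes B: "barrier_on B X" and "finite C" and col: "col ` B \<subseteq> C"
  shows "\<exists>Z\<subseteq>X. infinite Z \<and> (\<exists>c. \<forall>t\<in>B. t \<subseteq> Z \<longrightarrow> col t = c)"
proof -
  \<comment> \<open>Quantifying over all \<open>Y\<close> makes the property usable inside every
    infinite subset, as the diagonal argument requires.\<close>
  define P where "P s \<longleftrightarrow> (\<forall>Y. infinite Y \<and> Y \<subseteq> X \<longrightarrow> homogenizable B col C s Y)" for s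
  have "P {}"
  proof (rule ccontr)
    assume "\<not> P {}"
    \<comment> \<open>A failure at \<open>{}\<close> is propagated one end-point at a time.
      Recording \<open>card (S i) = i\<close> makes the union infinite and later identifies
      \<open>t\<close> by its size.\<close>
    have "\<exists>S. \<forall>i. (\<not> P (S i) \<and> finite (S i) \<and> S i \<subseteq> X \<and> card (S i) = i) \<and>
        (\<exists>n. (\<forall>y\<in>S i. y < n) \<and> S (Suc i) = insert n (S i))"
    proof (rule dependent_nat_choice)
      show "\<exists>s. \<not> P s \<and> finite s \<and> s \<subseteq> X \<and> card s = 0"
        using \<open>\<not> P {}\<close> by (intro exI[of _ "{}"]) auto
    next
      fix s and i :: nat
      assume s: "\<not> P s \<and> finite s \<and> s \<subseteq> X \<and> card s = i"
      then obtain Y where Y: "infinite Y" "Y \<subseteq> X" "\<not> homogenizable B col C s Y"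
        unfolding P_def by blast
      then have "s \<notin> B"
        using homogenizable_in_barrier[OF B] col by blast
      have "\<not> (\<forall>n\<in>X. (\<forall>y\<in>s. y < n) \<longrightarrow> P (insert n s))"
      proof
        assume *: "\<forall>n\<in>X. (\<forall>y\<in>s. y < n) \<longrightarrow> P (insert n s)"
        have "homogenizable B col C s Y"
          by (rule homogenizable_step[OF \<open>finite C\<close> \<open>s \<notin> B\<close> _ Y(1,2)])
            (use s * in \<open>simp_all add: P_def\<close>)
        with Y(3) show False ..
      qed
      then obtain n where n: "n \<in> X" "\<forall>y\<in>s. y < n" "\<not> P (insert n s)" by blast
      then have "n \<notin> s" by blast
      with n s show "\<exists>s'. (\<not> P s' \<and> finite s' \<and> s' \<subseteq> X \<and> card s' = Suc i) \<and>
          (\<exists>n. (\<forall>y\<in>s. y < n) \<and> s' = insert n s)"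
        by (intro exI[of _ "insert n s"]) auto
    qed
    then obtain S where S: "\<And>i. \<not> P (S i)" "\<And>i. finite (S i)" "\<And>i. S i \<subseteq> X" "\<And>i. card (S i) = i"
        "\<And>i. \<exists>n. (\<forall>y\<in>S i. y < n) \<and> S (Suc i) = insert n (S i)"
      by blast
    define Y where "Y = (\<Union>i. S i)"
    have "infinite Y"
    proof
      assume "finite Y"
      then have "card (S (Suc (card Y))) \<le> card Y"
        by (intro card_mono) (auto simp: Y_def)
      then show False using S(4) by simp
    qed
    moreover have "Y \<subseteq> X" using S(3) by (auto simp: Y_def)
    ultimately obtain t where t: "t \<in> B" "proper_init_seg t Y"
      using B unfolding barrier_on_def by meson
    have "finite t" using t unfolding proper_init_seg_def by blast
    have "init_seg (S i) Y" for i
    proof -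
      have above: "init_seg (S i) (S j)" if "i \<le> j" for j
        using that
      proof (induction j rule: dec_induct)
        case base
        show ?case by (simp add: init_seg_def)
      next
        case (step j)
        obtain n where "\<forall>y\<in>S j. y < n" "S (Suc j) = insert n (S j)"
          using S(5) by blast
        then show ?case using init_seg_insert[OF step.IH] by simp
      qed
      have below: "S j \<subseteq> S i" if "j \<le> i" for j
        by (rule lift_Suc_mono_le[OF _ that]) (use S(5) in blast)
      show ?thesis
        unfolding init_seg_def
      proof (intro conjI ballI)
        show "S i \<subseteq> Y" by (auto simp: Y_def)
        fix y x assume "y \<in> S i" "x \<in> Y - S i"
        then obtain j where "x \<in> S j - S i" by (auto simp: Y_def)
        moreover from this have "i \<le> j" using below[of j] by (meson DiffD1 DiffD2 nle_le subsetD)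
        ultimately show "y < x"
          using above \<open>y \<in> S i\<close> unfolding init_seg_def by blast
      qed
    qed
    \<comment> \<open>Both are initial segments of \<open>Y\<close>, hence comparable; having the
      same cardinality, they coincide. Thus \<open>P\<close> fails at a member of \<open>B\<close>,
      where it must hold.\<close>
    then have "t \<subseteq> S (card t) \<or> S (card t) \<subseteq> t"
      using init_seg_linear proper_init_seg_imp_init_seg[OF t(2) \<open>infinite Y\<close>] by blast
    then have "t = S (card t)"
      using S(2,4) \<open>finite t\<close> by (metis card_subset_eq)
    then have "\<not> P t" using S(1) by metis
    moreover have "P t"
      unfolding P_def using homogenizable_in_barrier[OF B t(1)] col t(1) by blast
    ultimately show False ..
  qed
  moreover have "infinite X" using B unfolding barrier_on_def by blast
  ultimately have "homogenizable B col C {} X" unfolding P_def by blast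
  \<comment> \<open>Every set has \<open>{}\<close> as an initial segment, so the restriction on
    \<open>t\<close> reduces to \<open>t \<subseteq> Z\<close>.\<close>
  then show ?thesis
    unfolding homogenizable_def init_seg_def by auto
qed

theorem mainTheorem3:
  fixes B :: "nat set set" and X :: "nat set" and k :: nat and f :: "nat set \<Rightarrow> nat"
  assumes "infinite X"
    and "barrier_on B X"
    and "bounded_fun_on k f B"
  shows "\<exists>B'. B' \<subseteq> B \<and> barrier B' \<and> inj_on f B'"
proof -
  have "\<exists>h. inj_on h {s \<in> B. f s = x} \<and> h ` {s \<in> B. f s = x} \<subseteq> {..<k}" for x
    using assms(3) card_le_inj[of "{s \<in> B. f s = x}" "{..<k}"]
    unfolding bounded_fun_on_def by auto
  then obtain h where h: "\<And>x. inj_on (h x) {s \<in> B. f s = x}"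
      "\<And>x. h x ` {s \<in> B. f s = x} \<subseteq> {..<k}"
    by metis
  \<comment> \<open>The colour numbers \<open>s\<close> within its own fibre, so equal colour and
    equal \<open>f\<close>-value force equality.\<close>
  define col where "col s = h (f s) s" for s
  have "col ` B \<subseteq> {..<k}"
    using h(2) unfolding col_def by blast
  from Nash_Williams[OF assms(2) _ this] obtain Z c where
    Z: "Z \<subseteq> X" "infinite Z" "\<And>t. t \<in> B \<Longrightarrow> t \<subseteq> Z \<Longrightarrow> col t = c"
    by auto
  have "inj_on f {s \<in> B. s \<subseteq> Z}"
  proof (rule inj_onI)
    fix s t assume st: "s \<in> {s \<in> B. s \<subseteq> Z}" "t \<in> {s \<in> B. s \<subseteq> Z}" "f s = f t"
    then have "h (f s) s = h (f s) t"
      using Z(3)[of s] Z(3)[of t] unfolding col_def by simp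
    then show "s = t"
      using h(1)[of "f s"] st unfolding inj_on_def by auto
  qed
  moreover have "barrier {s \<in> B. s \<subseteq> Z}"
    using barrier_restrict[OF assms(2) Z(2,1)] .
  ultimately show ?thesis
    by (intro exI[of _ "{s \<in> B. s \<subseteq> Z}"]) auto
qed

end
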